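(* Let $X$ be an equiangular set with angle $\frac15$ and base size $K(X)=4$ in $\mathbb{R}^r$. Then $$|X|\leq 100+3\cdot s\Bigl(r-4,\tfrac{1}{13},-\tfrac{5}{13}\Bigr).$$
   Context: Equiangular set: a finite set $X=\{x_1,\dots,x_s\}$ of unit vectors in $\mathbb{R}^r$ is equiangular with angle $\alpha\in[0,1)$ if $\langle x_i,x_j\rangle\in\{-\alpha,\alpha\}$ for all $i\neq j$. For Gram matrices write $G\simeq G'$ if $G'=(CB)^{T}G(CB)$ with $B$ a diagonal $\pm1$ matrix and $C$ a permutation matrix. $I$ is the identity and $J$ the all-one matrix. Base size: $K(X)$ is the largest $k$ for which there are $p_1,\dots,p_k\in X$ whose Gram matrix satisfies $G(p_1,\dots,p_k)\simeq(1+\alpha)I-\alpha J$; equivalently, the largest $k$ such that, after replacing some vectors of $X$ by their negatives, there are $k$ vectors with pairwise inner products $-\alpha$. $s(d,a,b)$ denotes the maximum number of vectors in a spherical two-distance set in $\mathbb{R}^{d}$ with inner products $a$ and $b$, i.e. a set of unit vectors in $\mathbb{R}^d$ such that any two distinct vectors have inner product in $\{a,b\}$. *)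

theory Defs
  imports Complex_Main "HOL-Combinatorics.Permutations" "Jordan_Normal_Form.Matrix"
begin

text \<open>
  Since the dimensions \<open>r\<close> and \<open>r - 4\<close> occur in one statement, Euclidean space of dimension
  \<open>d\<close> is \<open>carrier_vec d :: real vec set\<close> with the inner product \<open>scalar_prod\<close>.
\<close>

definition equiangular :: "nat \<Rightarrow> real \<Rightarrow> real vec set \<Rightarrow> bool" where
  "equiangular r \<alpha> X \<longleftrightarrow>
     0 \<le> \<alpha> \<and> \<alpha> < 1 \<and> finite X \<and> X \<subseteq> carrier_vec r \<and>
     (\<forall>x\<in>X. x \<bullet> x = 1) \<and>
     (\<forall>x\<in>X. \<forall>y\<in>X. x \<noteq> y \<longrightarrow> x \<bullet> y \<in> {-\<alpha>, \<alpha>})"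

definition gram :: "real vec list \<Rightarrow> real mat" where
  "gram ps = mat (length ps) (length ps) (\<lambda>(i, j). (ps ! i) \<bullet> (ps ! j))"

definition all_ones_mat :: "nat \<Rightarrow> real mat" where
  "all_ones_mat n = mat n n (\<lambda>_. 1)"

definition permutation_mats :: "nat \<Rightarrow> real mat set" where
  "permutation_mats n =
     {mat n n (\<lambda>(i, j). if i = \<pi> j then 1 else 0) | \<pi>. \<pi> permutes {..<n}}"

definition sign_mats :: "nat \<Rightarrow> real mat set" where
  "sign_mats n = {mat_diag n b | b. \<forall>i<n. b i \<in> {-1, 1}}"

definition gram_equiv :: "real mat \<Rightarrow> real mat \<Rightarrow> bool" (infix \<open>\<simeq>\<^sub>G\<close> 50) where
  "G \<simeq>\<^sub>G G' \<longleftrightarrow>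
     (\<exists>n. G \<in> carrier_mat n n \<and> G' \<in> carrier_mat n n \<and>
       (\<exists>B\<in>sign_mats n. \<exists>C\<in>permutation_mats n.
          G' = transpose_mat (C * B) * G * (C * B)))"

definition base_size :: "real \<Rightarrow> real vec set \<Rightarrow> nat" where
  "base_size \<alpha> X =
     Max {k. \<exists>ps. length ps = k \<and> set ps \<subseteq> X \<and>
            gram ps \<simeq>\<^sub>G (1 + \<alpha>) \<cdot>\<^sub>m 1\<^sub>m k - \<alpha> \<cdot>\<^sub>m all_ones_mat k}"

definition spherical_two_distance :: "nat \<Rightarrow> real \<Rightarrow> real \<Rightarrow> real vec set \<Rightarrow> bool" where
  "spherical_two_distance d a b S \<longleftrightarrow>
     S \<subseteq> carrier_vec d \<and> (\<forall>x\<in>S. x \<bullet> x = 1) \<and>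
     (\<forall>x\<in>S. \<forall>y\<in>S. x \<noteq> y \<longrightarrow> x \<bullet> y \<in> {a, b})"

definition max_two_distance :: "nat \<Rightarrow> real \<Rightarrow> real \<Rightarrow> nat" where
  "max_two_distance d a b = Max {card S | S. spherical_two_distance d a b S}"

text \<open>
  The sets under both occurrences of \<open>Max\<close> are finite (for \<open>base_size\<close>, when \<open>X\<close> is
  equiangular) and nonempty, and spherical two-distance sets are finite, so both numbers are
  genuine maxima.
\<close>

lemma dist_sq_vec:
  fixes x y :: "real vec"
  assumes "x \<in> carrier_vec d" "y \<in> carrier_vec d"
  shows "(\<Sum>i<d. (x $ i - y $ i)\<^sup>2) = x \<bullet> x + y \<bullet> y - 2 * (x \<bullet> y)"
proof -
  have "(\<Sum>i<d. (x $ i - y $ i)\<^sup>2)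
      = (\<Sum>i<d. x $ i * x $ i + y $ i * y $ i - 2 * (x $ i * y $ i))"
    by (intro sum.cong) (auto simp: power2_eq_square algebra_simps)
  also have "\<dots> = x \<bullet> x + y \<bullet> y - 2 * (x \<bullet> y)"
    using assms by (simp add: scalar_prod_def atLeast0LessThan sum.distrib sum_subtractf
        sum_distrib_left)
  finally show ?thesis .
qed

lemma unit_inner_less_1:
  fixes x y :: "real vec"
  assumes x: "x \<in> carrier_vec d" and y: "y \<in> carrier_vec d"
    and u: "x \<bullet> x = 1" "y \<bullet> y = 1" and ne: "x \<noteq> y"
  shows "x \<bullet> y < 1"
proof -
  obtain i where i: "i < d" "x $ i \<noteq> y $ i"
    using ne x y by (metis carrier_vecD eq_vecI)
  have "0 < (x $ i - y $ i)\<^sup>2" using i by simp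
  also have "\<dots> \<le> (\<Sum>i<d. (x $ i - y $ i)\<^sup>2)"
    using i(1) by (intro member_le_sum) auto
  finally show ?thesis using dist_sq_vec[OF x y] u by simp
qed

lemma two_distance_bounded:
  "\<exists>N. \<forall>S. spherical_two_distance d a b S \<longrightarrow> finite S \<and> card S \<le> N"
proof -
  define c where "c = (if a < 1 then if b < 1 then max a b else a else if b < 1 then b else 0)"
  have c: "c < 1" by (auto simp: c_def)
  define N :: real where "N = (real d + 1) / (1 - c) + 1"
  have N1: "N \<ge> 1" using c by (auto simp: N_def)
  have Nb: "real d / N\<^sup>2 < 2 - 2 * c"
  proof -
    have "N * (1 - c) = (real d + 1) / (1 - c) * (1 - c) + (1 - c)"
      unfolding N_def by (simp only: distrib_right mult_1_left)
    also have "(real d + 1) / (1 - c) * (1 - c) = real d + 1"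
      using c by (intro nonzero_eq_divide_eq[THEN iffD1] refl) simp
    finally have "N * (1 - c) = real d + 1 + (1 - c)" .
    hence "real d < N * (1 - c)" using c by simp
    also have "\<dots> \<le> N\<^sup>2 * (1 - c)" using N1 c by (simp add: power2_eq_square)
    also have "\<dots> \<le> N\<^sup>2 * (2 - 2 * c)" using c by (intro mult_left_mono) auto
    finally show ?thesis using N1 by (simp add: field_simps)
  qed
  define D where "D = {..<d} \<rightarrow>\<^sub>E {\<lfloor>-N\<rfloor>..\<lfloor>N\<rfloor>}"
  have finD: "finite D" unfolding D_def by (intro finite_PiE) auto
  have "finite S \<and> card S \<le> card D" if S: "spherical_two_distance d a b S" for S
  proof -
    define f where "f x = restrict (\<lambda>i. \<lfloor>N * x $ i\<rfloor>) {..<d}" for x :: "real vec"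
    have "f ` S \<subseteq> D"
    proof
      fix g assume "g \<in> f ` S"
      then obtain x where x: "x \<in> S" and g: "g = f x" by auto
      have xc: "x \<in> carrier_vec d" "x \<bullet> x = 1"
        using S x by (auto simp: spherical_two_distance_def)
      have "\<lfloor>N * x $ i\<rfloor> \<in> {\<lfloor>-N\<rfloor>..\<lfloor>N\<rfloor>}" if i: "i < d" for i
      proof -
        have "(x $ i)\<^sup>2 \<le> (\<Sum>i<d. (x $ i)\<^sup>2)"
          using i by (intro member_le_sum) auto
        also have "\<dots> = 1"
          using xc by (simp add: scalar_prod_def power2_eq_square atLeast0LessThan)
        finally have "\<bar>x $ i\<bar> \<le> 1" by (simp add: abs_square_le_1)
        hence "x $ i \<le> 1" "-1 \<le> x $ i" by auto
        hence "N * x $ i \<le> N * 1" "N * -1 \<le> N * x $ i" using N1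
          by (intro mult_left_mono; simp)+
        hence "\<lfloor>-N\<rfloor> \<le> \<lfloor>N * x $ i\<rfloor>" "\<lfloor>N * x $ i\<rfloor> \<le> \<lfloor>N\<rfloor>"
          by (auto intro!: floor_mono)
        thus ?thesis by simp
      qed
      thus "g \<in> D" by (auto simp: g f_def D_def)
    qed
    moreover have "inj_on f S"
    proof (rule inj_onI, rule ccontr)
      fix x y assume xy: "x \<in> S" "y \<in> S" "f x = f y" "x \<noteq> y"
      have cx: "x \<in> carrier_vec d" "y \<in> carrier_vec d" "x \<bullet> x = 1" "y \<bullet> y = 1" "x \<bullet> y \<in> {a, b}"
        using S xy by (auto simp: spherical_two_distance_def)
      have "x \<bullet> y < 1" using unit_inner_less_1[OF cx(1-4) xy(4)] .
      hence le: "x \<bullet> y \<le> c" using cx(5) by (auto simp: c_def)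
      have "(x $ i - y $ i)\<^sup>2 \<le> 1 / N\<^sup>2" if i: "i < d" for i
      proof -
        have "\<lfloor>N * x $ i\<rfloor> = \<lfloor>N * y $ i\<rfloor>"
          using fun_cong[OF xy(3), of i] i by (simp add: f_def)
        hence "\<bar>N * x $ i - N * y $ i\<bar> \<le> 1" by linarith
        hence "(N * x $ i - N * y $ i)\<^sup>2 \<le> 1" by (simp add: abs_square_le_1)
        hence "N\<^sup>2 * (x $ i - y $ i)\<^sup>2 \<le> 1"
          by (simp add: right_diff_distrib[symmetric] power_mult_distrib)
        thus ?thesis using N1 by (simp add: field_simps)
      qed
      hence "(\<Sum>i<d. (x $ i - y $ i)\<^sup>2) \<le> (\<Sum>i<d. 1 / N\<^sup>2)" by (intro sum_mono) auto
      thus False using dist_sq_vec[OF cx(1,2)] cx(3,4) le Nb by simp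
    qed
    ultimately show ?thesis
      using finD by (meson card_inj_on_le finite_imageD finite_subset)
  qed
  thus ?thesis by blast
qed

lemma finite_two_distance_cards: "finite {card S | S. spherical_two_distance d a b S}"
proof -
  obtain N where "\<forall>S. spherical_two_distance d a b S \<longrightarrow> finite S \<and> card S \<le> N"
    using two_distance_bounded by blast
  thus ?thesis by (auto intro!: finite_subset[of _ "{..N}"])
qed

lemma max_two_distance_attained:
  "\<exists>S. spherical_two_distance d a b S \<and> finite S \<and> card S = max_two_distance d a b"
proof -
  have "spherical_two_distance d a b {}" by (simp add: spherical_two_distance_def)
  hence "{card S | S. spherical_two_distance d a b S} \<noteq> {}" by blast
  from Max_in[OF finite_two_distance_cards this] show ?thesis
    using two_distance_bounded[of d a b] unfolding max_two_distance_def by fastforce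
qed

lemma card_le_max_two_distance:
  "spherical_two_distance d a b S \<Longrightarrow> card S \<le> max_two_distance d a b"
  unfolding max_two_distance_def by (intro Max_ge finite_two_distance_cards) auto

lemma signed_permuted_entry:
  fixes G :: "real mat"
  assumes G: "G \<in> carrier_mat n n" and p: "\<pi> permutes {..<n}" and ij: "i < n" "j < n"
    and C: "C = mat n n (\<lambda>(i, j). if i = \<pi> j then 1 else 0)"
  shows "(transpose_mat (C * mat_diag n b) * G * (C * mat_diag n b)) $$ (i, j)
           = b i * b j * G $$ (\<pi> i, \<pi> j)"
proof -
  define P where "P = C * mat_diag n b"
  have \<pi>: "\<pi> k < n" if "k < n" for k
    using permutes_in_image[OF p, of k] that by simp
  have Cc: "C \<in> carrier_mat n n" by (simp add: C)
  have Pc: "P \<in> carrier_mat n n"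
    unfolding P_def by (rule mult_carrier_mat[OF Cc mat_diag_dim])
  have P: "P $$ (k, l) = (if k = \<pi> l then b l else 0)" if "k < n" "l < n" for k l
    using that unfolding P_def mat_diag_mult_right[OF Cc] by (simp add: C)
  have "(transpose_mat P * G) $$ (i, l) = b i * G $$ (\<pi> i, l)" if l: "l < n" for l
  proof -
    have "(transpose_mat P * G) $$ (i, l) = (\<Sum>k<n. P $$ (k, i) * G $$ (k, l))"
      using Pc G ij l by (simp add: scalar_prod_def atLeast0LessThan)
    also have "\<dots> = (\<Sum>k<n. if k = \<pi> i then b i * G $$ (k, l) else 0)"
      using P ij by (intro sum.cong) auto
    finally show ?thesis using \<pi>[OF ij(1)] by simp
  qed
  moreover have "(transpose_mat P * G * P) $$ (i, j)
      = (\<Sum>l<n. (transpose_mat P * G) $$ (i, l) * P $$ (l, j))"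
  proof -
    define M where "M = transpose_mat P * G"
    have "M \<in> carrier_mat n n" using Pc G by (simp add: M_def)
    thus ?thesis
      unfolding M_def[symmetric] using Pc ij by (simp add: scalar_prod_def atLeast0LessThan)
  qed
  moreover have "(\<Sum>l<n. b i * G $$ (\<pi> i, l) * (if l = \<pi> j then b j else 0))
      = (\<Sum>l<n. if l = \<pi> j then b i * b j * G $$ (\<pi> i, l) else 0)"
    by (intro sum.cong) auto
  ultimately have "(transpose_mat P * G * P) $$ (i, j)
      = (\<Sum>l<n. if l = \<pi> j then b i * b j * G $$ (\<pi> i, l) else 0)"
    using P ij by simp
  thus ?thesis using \<pi>[OF ij(2)] by (simp add: P_def)
qed

lemma base_distinct:
  assumes X: "equiangular r \<alpha> X" and ps: "set ps \<subseteq> X" "length ps = k"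
    and e: "gram ps \<simeq>\<^sub>G (1 + \<alpha>) \<cdot>\<^sub>m 1\<^sub>m k - \<alpha> \<cdot>\<^sub>m all_ones_mat k"
  shows "distinct ps"
proof -
  obtain b \<pi> where b: "\<forall>i<k. b i \<in> {-1, 1}" and p: "\<pi> permutes {..<k}"
    and eq: "(1 + \<alpha>) \<cdot>\<^sub>m 1\<^sub>m k - \<alpha> \<cdot>\<^sub>m all_ones_mat k
      = transpose_mat (mat k k (\<lambda>(i, j). if i = \<pi> j then 1 else 0) * mat_diag k b) * gram ps *
        (mat k k (\<lambda>(i, j). if i = \<pi> j then 1 else 0) * mat_diag k b)"
    using e ps(2) unfolding gram_equiv_def sign_mats_def permutation_mats_def
    by (auto simp: gram_def)
  have entry: "- \<alpha> = b i * b j * (ps ! \<pi> i \<bullet> ps ! \<pi> j)" if ij: "i < k" "j < k" "i \<noteq> j" for i j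
  proof -
    have "\<pi> i < k" "\<pi> j < k" using permutes_in_image[OF p] ij by auto
    thus ?thesis
      using arg_cong[OF eq, of "\<lambda>M. M $$ (i, j)"] ij ps(2)
        signed_permuted_entry[OF _ p ij(1,2) refl, of "gram ps" b]
      by (simp add: gram_def all_ones_mat_def)
  qed
  show ?thesis unfolding distinct_conv_nth
  proof (intro allI impI notI)
    fix m n assume mn: "m < length ps" "n < length ps" "m \<noteq> n" "ps ! m = ps ! n"
    obtain i j where ij: "i < k" "j < k" "m = \<pi> i" "n = \<pi> j"
      using mn ps(2) permutes_image[OF p] by (metis imageE lessThan_iff)
    have "ps ! m \<bullet> ps ! n = 1" using mn ps X
      by (metis equiangular_def nth_mem subsetD)
    moreover have "b i \<in> {-1, 1}" "b j \<in> {-1, 1}" using b ij by auto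
    moreover have "i \<noteq> j" using ij mn by auto
    ultimately have "\<alpha> \<in> {-1, 1}" using entry[OF ij(1,2)] ij(3,4) by auto
    thus False using X by (auto simp: equiangular_def)
  qed
qed

lemma finite_base_sizes:
  assumes "equiangular r \<alpha> X"
  shows "finite {k. \<exists>ps. length ps = k \<and> set ps \<subseteq> X \<and>
            gram ps \<simeq>\<^sub>G (1 + \<alpha>) \<cdot>\<^sub>m 1\<^sub>m k - \<alpha> \<cdot>\<^sub>m all_ones_mat k}" (is "finite ?K")
proof -
  have fin: "finite X" using assms by (simp add: equiangular_def)
  have "?K \<subseteq> {..card X}"
  proof
    fix k assume "k \<in> ?K"
    then obtain ps where ps: "length ps = k" "set ps \<subseteq> X"
        "gram ps \<simeq>\<^sub>G (1 + \<alpha>) \<cdot>\<^sub>m 1\<^sub>m k - \<alpha> \<cdot>\<^sub>m all_ones_mat k"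
      by blast
    have "card (set ps) = k"
      using base_distinct[OF assms ps(2,1,3)] ps(1) distinct_card by blast
    thus "k \<in> {..card X}" using card_mono[OF fin ps(2)] by simp
  qed
  thus ?thesis by (rule finite_subset) simp
qed

lemma zero_base_size:
  "\<exists>ps. length ps = 0 \<and> set ps \<subseteq> X \<and>
     gram ps \<simeq>\<^sub>G (1 + \<alpha>) \<cdot>\<^sub>m 1\<^sub>m 0 - \<alpha> \<cdot>\<^sub>m all_ones_mat 0"
proof -
  have "mat_diag 0 (\<lambda>_. 1) \<in> sign_mats 0" unfolding sign_mats_def by blast
  moreover have "mat 0 0 (\<lambda>(i, j). if i = id j then 1 else 0) \<in> permutation_mats 0"
    unfolding permutation_mats_def using permutes_id by blast
  ultimately have "gram [] \<simeq>\<^sub>G (1 + \<alpha>) \<cdot>\<^sub>m 1\<^sub>m 0 - \<alpha> \<cdot>\<^sub>m all_ones_mat 0"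
    unfolding gram_equiv_def
    by (intro exI[of _ 0] conjI bexI) (auto simp: gram_def all_ones_mat_def)
  thus ?thesis by (intro exI[of _ "[]"]) simp
qed

end

theory Submission
  imports Defs
begin

text \<open>
  Choose signs so that four vectors of \<open>X\<close> have mutual inner products \<open>-1/5\<close>; these form the base.
  Every other vector has inner products \<open>1/5\<close> or \<open>-1/5\<close> with the base, and the set of base vectors
  where the value is \<open>1/5\<close> assigns it to a pillar. As a line determines its vector only up to sign,
  a pattern and its complement describe the same lines. The pattern with no positive sign would
  enlarge the base, so there remain four pillars \<open>{i}\<close> and three pillars \<open>{0, j}\<close>.

  All members of a pillar have the same projection to the span of the base, so differences in their
  inner products are visible in the orthogonal complement, which has dimension \<open>r - 4\<close>. In a pillar
  \<open>{0, j}\<close> the perpendicular parts, scaled to unit length, form a two-distance set with inner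
  products \<open>1/13\<close> and \<open>-5/13\<close> (\<open>card_pair_pillar_le\<close>): this is the term with the factor three. In a
  pillar \<open>{i}\<close>, maximality of the base forces all inner products to be \<open>1/5\<close>, and the perpendicular
  parts are pairwise orthogonal. A single such pillar can be as large as the dimension permits, but
  orthogonality makes it nearly incompatible with other pillars: by Bessel it has at most 39 vectors
  beside a nonempty pillar \<open>{0, j}\<close> (\<open>card_singleton_pillar_le_39\<close>), and two nonempty pillars \<open>{i}\<close>
  have at most 48 vectors together (\<open>orthogonal_pair_card_le\<close>), so that all four have at most 96. If one
  pillar \<open>{i}\<close> is all there is beside the base, its orthogonal family can be tilted into a set with
  constant inner product \<open>1/13\<close>, so one of the three terms already bounds it
  (\<open>card_singleton_pillar_le\<close>). The base accounts for the remaining four vectors.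
\<close>

section \<open>Inner products of coordinate functions and Bessel's inequality\<close>

text \<open>
  Vectors are coordinate functions here, of which the first \<open>d\<close> values count. Linear combinations
  are then plain functions without a dimension attached, so that bilinearity holds without side
  conditions and the same notation serves for all dimensions.
\<close>

definition ip :: "nat \<Rightarrow> (nat \<Rightarrow> real) \<Rightarrow> (nat \<Rightarrow> real) \<Rightarrow> real" where
  "ip d f g = (\<Sum>k<d. f k * g k)"

lemma ip_commute: "ip d f g = ip d g f"
  by (simp add: ip_def mult.commute)

lemma ip_self_nonneg: "0 \<le> ip d f f"
  by (simp add: ip_def sum_nonneg)

lemma ip_linear_left:
  "ip d (\<lambda>k. f k + g k) h = ip d f h + ip d g h"
  "ip d (\<lambda>k. f k - g k) h = ip d f h - ip d g h"
  "ip d (\<lambda>k. c * f k) h = c * ip d f h"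
  "ip d (\<lambda>k. \<Sum>i\<in>A. F i k) h = (\<Sum>i\<in>A. ip d (F i) h)"
  by (simp_all add: ip_def algebra_simps sum.distrib sum_subtractf sum_distrib_left
      sum_distrib_right sum.swap[of _ A])

lemma ip_linear_right:
  "ip d h (\<lambda>k. f k + g k) = ip d h f + ip d h g"
  "ip d h (\<lambda>k. f k - g k) = ip d h f - ip d h g"
  "ip d h (\<lambda>k. c * f k) = c * ip d h f"
  "ip d h (\<lambda>k. \<Sum>i\<in>A. F i k) = (\<Sum>i\<in>A. ip d h (F i))"
  by (simp_all only: ip_commute[of d h] ip_linear_left)

lemmas ip_linear = ip_linear_left ip_linear_right

lemma ip_vec_index: "y \<in> carrier_vec d \<Longrightarrow> ip d (($) x) (($) y) = x \<bullet> y"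
  by (auto simp: ip_def scalar_prod_def atLeast0LessThan)

lemma sum_orthogonal_row:
  assumes "finite A" "x \<in> A" and "\<And>y. y \<in> A \<Longrightarrow> x \<noteq> y \<Longrightarrow> ip d (e x) (e y) = 0"
  shows "(\<Sum>y\<in>A. c y * ip d (e x) (e y)) = c x * ip d (e x) (e x)"
proof -
  have "(\<Sum>y\<in>A. c y * ip d (e x) (e y)) = (\<Sum>y\<in>A. if y = x then c x * ip d (e x) (e x) else 0)"
    using assms(3) by (intro sum.cong) auto
  thus ?thesis using assms by simp
qed

text \<open>
  If the inner products with \<open>f\<close> stay away from zero, this bounds the size of the orthogonal family.
  The proof expands the squared norm of \<open>f\<close> minus its projection \<open>g\<close> to the span of the family.
\<close>

lemma bessel:
  assumes A: "finite A" and a: "a > 0"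
    and norm: "\<And>x. x \<in> A \<Longrightarrow> ip d (e x) (e x) = a"
    and orth: "\<And>x y. x \<in> A \<Longrightarrow> y \<in> A \<Longrightarrow> x \<noteq> y \<Longrightarrow> ip d (e x) (e y) = 0"
  shows "(\<Sum>x\<in>A. (ip d (e x) f)\<^sup>2) \<le> a * ip d f f"
proof -
  define c where "c x = ip d (e x) f / a" for x
  define g where "g = (\<lambda>k. \<Sum>x\<in>A. c x * e x k)"
  have gf: "ip d g f = (\<Sum>x\<in>A. (ip d (e x) f)\<^sup>2) / a"
    by (simp add: g_def ip_linear) (simp add: c_def sum_divide_distrib power2_eq_square)
  have "ip d g g = (\<Sum>x\<in>A. c x * (\<Sum>y\<in>A. c y * ip d (e x) (e y)))"
    by (simp add: g_def ip_linear_left) (simp add: ip_linear_right)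
  also have "\<dots> = (\<Sum>x\<in>A. c x * (c x * a))"
  proof (intro sum.cong refl)
    fix x assume x: "x \<in> A"
    show "c x * (\<Sum>y\<in>A. c y * ip d (e x) (e y)) = c x * (c x * a)"
      using sum_orthogonal_row[OF A x, of d e c] orth[OF x] norm[OF x] by simp
  qed
  also have "\<dots> = ip d g f"
    using a by (simp add: gf c_def sum_divide_distrib power2_eq_square)
  finally have gg: "ip d g g = ip d g f" .
  have "0 \<le> ip d (\<lambda>k. f k - g k) (\<lambda>k. f k - g k)" by (rule ip_self_nonneg)
  also have "\<dots> = ip d f f - ip d g f"
    by (simp add: ip_linear gg ip_commute[of d f g])
  finally show ?thesis using a by (simp add: gf field_simps)
qed

lemma orthogonal_sum_norm:
  assumes A: "finite A"
    and norm: "\<And>x. x \<in> A \<Longrightarrow> ip d (e x) (e x) = a"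
    and orth: "\<And>x y. x \<in> A \<Longrightarrow> y \<in> A \<Longrightarrow> x \<noteq> y \<Longrightarrow> ip d (e x) (e y) = 0"
  shows "ip d (\<lambda>k. \<Sum>x\<in>A. e x k) (\<lambda>k. \<Sum>x\<in>A. e x k) = real (card A) * a"
proof -
  have "ip d (\<lambda>k. \<Sum>x\<in>A. e x k) (\<lambda>k. \<Sum>x\<in>A. e x k) = (\<Sum>x\<in>A. \<Sum>y\<in>A. 1 * ip d (e x) (e y))"
    by (simp add: ip_linear_left) (simp add: ip_linear_right)
  also have "\<dots> = (\<Sum>x\<in>A. 1 * a)"
  proof (intro sum.cong refl)
    fix x assume x: "x \<in> A"
    show "(\<Sum>y\<in>A. 1 * ip d (e x) (e y)) = 1 * a"
      using sum_orthogonal_row[OF A x, of d e "\<lambda>_. 1"] orth[OF x] norm[OF x] by simp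
  qed
  finally show ?thesis by simp
qed

text \<open>
  Every entry \<open>t\<close> of the cross Gram matrix is a root of \<open>(t - 2/15) (t + 4/15)\<close>, hence
  \<open>t = 4/15 - 15/2 t\<^sup>2\<close>: a bound on the squares turns into a lower bound on the sum. With
  \<open>n = card A\<close> and \<open>m = card B\<close>, Bessel bounds the squares in each row by \<open>16/25\<close>, so the sum of
  all entries is at least \<open>4 n (m - 18) / 15\<close>. That sum is the inner product of the two total
  vectors, whose squared norms are \<open>4 n / 5\<close> and \<open>4 m / 5\<close>, and Cauchy-Schwarz yields
  \<open>n (m - 18)\<^sup>2 \<le> 9 m\<close>, which is impossible when \<open>1 \<le> n \<le> m\<close> and \<open>n + m > 48\<close>.
\<close>

lemma orthogonal_pair_card_le:
  assumes A: "finite A" "A \<noteq> {}" and B: "finite B" and le: "card A \<le> card B"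
    and eA: "\<And>x. x \<in> A \<Longrightarrow> ip d (e x) (e x) = 4/5"
      "\<And>x y. x \<in> A \<Longrightarrow> y \<in> A \<Longrightarrow> x \<noteq> y \<Longrightarrow> ip d (e x) (e y) = 0"
    and eB: "\<And>x. x \<in> B \<Longrightarrow> ip d (f x) (f x) = 4/5"
      "\<And>x y. x \<in> B \<Longrightarrow> y \<in> B \<Longrightarrow> x \<noteq> y \<Longrightarrow> ip d (f x) (f y) = 0"
    and cross: "\<And>x y. x \<in> A \<Longrightarrow> y \<in> B \<Longrightarrow> ip d (e x) (f y) \<in> {2/15, -4/15}"
  shows "card A + card B \<le> 48"
proof (cases "card B \<le> 18")
  case True
  thus ?thesis using le by simp
next
  case False
  define n m where "n = real (card A)" and "m = real (card B)"
  have n1: "n \<ge> 1" using A by (simp add: n_def Suc_le_eq card_gt_0_iff)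
  have m18: "m > 18" using False by (simp add: m_def)
  define t where "t x y = ip d (e x) (f y)" for x y
  define S where "S = (\<Sum>x\<in>A. \<Sum>y\<in>B. t x y)"
  have t: "t x y = 4/15 - 15/2 * (t x y)\<^sup>2" if "x \<in> A" "y \<in> B" for x y
  proof -
    have "t x y = 2/15 \<or> t x y = -4/15" using cross[OF that] by (simp add: t_def)
    hence "(t x y - 2/15) * (t x y + 4/15) = 0" unfolding mult_eq_0_iff by linarith
    thus ?thesis by (simp add: power2_eq_square algebra_simps)
  qed
  have row: "(\<Sum>y\<in>B. (t x y)\<^sup>2) \<le> 16/25" if "x \<in> A" for x
  proof -
    have "(\<Sum>y\<in>B. (ip d (f y) (e x))\<^sup>2) \<le> 4/5 * ip d (e x) (e x)"
      by (rule bessel[OF B _ eB]) auto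
    also have "(\<Sum>y\<in>B. (ip d (f y) (e x))\<^sup>2) = (\<Sum>y\<in>B. (t x y)\<^sup>2)"
      by (simp only: t_def ip_commute)
    finally show ?thesis using eA(1)[OF that] by simp
  qed
  have "(\<Sum>x\<in>A. m * 4/15 - 15/2 * (16/25)) \<le> (\<Sum>x\<in>A. \<Sum>y\<in>B. t x y)"
  proof (rule sum_mono)
    fix x assume x: "x \<in> A"
    have "(\<Sum>y\<in>B. t x y) = (\<Sum>y\<in>B. 4/15 - 15/2 * (t x y)\<^sup>2)"
      using t[OF x] by (intro sum.cong) auto
    also have "\<dots> = m * 4/15 - 15/2 * (\<Sum>y\<in>B. (t x y)\<^sup>2)"
      by (simp add: sum_subtractf sum_distrib_left m_def)
    finally show "m * 4/15 - 15/2 * (16/25) \<le> (\<Sum>y\<in>B. t x y)" using row[OF x] by simp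
  qed
  hence S_ge: "4/15 * n * (m - 18) \<le> S" by (simp add: S_def n_def algebra_simps)
  define E where "E = (\<lambda>k. \<Sum>x\<in>A. e x k)"
  define F where "F = (\<lambda>k. \<Sum>y\<in>B. f y k)"
  have EE: "ip d E E = n * (4/5)" unfolding E_def n_def by (rule orthogonal_sum_norm[OF A(1) eA])
  have FF: "ip d F F = m * (4/5)" unfolding F_def m_def by (rule orthogonal_sum_norm[OF B eB])
  have "ip d E F = S" by (simp add: E_def F_def S_def t_def ip_linear_left) (simp add: ip_linear_right)
  \<comment> \<open>Cauchy-Schwarz is the case of Bessel in which the family is the single vector \<open>E\<close>.\<close>
  hence "S\<^sup>2 \<le> (4/5 * n) * (4/5 * m)"
    using bessel[of "{()}" "4/5 * n" d "\<lambda>_. E" F] EE FF n1 by simp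
  moreover have "(4/15 * n * (m - 18))\<^sup>2 \<le> S\<^sup>2"
    using S_ge n1 m18 by (intro power_mono) auto
  ultimately have "n * (n * (m - 18)\<^sup>2) \<le> n * (9 * m)"
    by (simp add: power2_eq_square algebra_simps)
  hence key: "n * (m - 18)\<^sup>2 \<le> 9 * m" using n1 by simp
  have "1 * (m - 18)\<^sup>2 \<le> n * (m - 18)\<^sup>2" using n1 by (intro mult_right_mono) auto
  hence "(m - 9) * (m - 36) \<le> 0" using key by (simp add: power2_eq_square algebra_simps)
  hence m36: "m \<le> 36" using m18 by (simp add: mult_le_0_iff)
  show ?thesis
  proof (cases "card A \<le> 12")
    case True
    thus ?thesis using m36 by (simp add: m_def)
  next
    case False
    hence "13 * (m - 18)\<^sup>2 \<le> n * (m - 18)\<^sup>2" by (intro mult_right_mono) (auto simp: n_def)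
    hence *: "13 * (m - 18)\<^sup>2 \<le> 9 * m" using key by simp
    have "m < 24"
    proof (rule ccontr)
      assume "\<not> m < 24"
      hence "6 * 6 \<le> (m - 18) * (m - 18)" by (intro mult_mono) auto
      thus False using * m36 by (simp add: power2_eq_square)
    qed
    thus ?thesis using le by (simp add: m_def)
  qed
qed

section \<open>Orthogonal complements in lower dimension\<close>

text \<open>
  The hyperplane orthogonal to \<open>w\<close> is isometric to the space of one dimension less: the reflection
  that exchanges the unit vector \<open>u\<close> along \<open>w\<close> with the first basis vector maps it onto the
  hyperplane where the first coordinate vanishes, and that coordinate can be dropped. The
  map \<open>F\<close> of the proof agrees with this composition on vectors orthogonal to \<open>w\<close>.
\<close>

lemma drop_dimension:
  assumes w: "ip (Suc n) w w > 0"
  shows "\<exists>F. \<forall>x y. ip (Suc n) x w = 0 \<longrightarrow> ip (Suc n) y w = 0 \<longrightarrow>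
           ip n (F x) (F y) = ip (Suc n) x y"
proof -
  define N where "N = sqrt (ip (Suc n) w w)"
  have N: "N > 0" "N * N = ip (Suc n) w w" using w by (auto simp: N_def)
  \<comment> \<open>The sign makes \<open>u 0\<close> nonpositive, so that the denominator \<open>1 - u 0\<close> of the reflection is not zero.\<close>
  define s where "s = (if w 0 \<le> 0 then 1/N else -1/N)"
  define u where "u = (\<lambda>k. s * w k)"
  have ss: "s * s * ip (Suc n) w w = 1" using N(1) by (simp add: s_def flip: N(2))
  have u0: "u 0 \<le> 0" using N by (auto simp: u_def s_def divide_simps)
  have uu: "ip (Suc n) u u = 1" using ss by (simp add: u_def ip_linear)
  have shift: "ip (Suc n) f g = f 0 * g 0 + ip n (\<lambda>k. f (Suc k)) (\<lambda>k. g (Suc k))" for f g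
    unfolding ip_def by (rule sum.lessThan_Suc_shift)
  define F where "F x = (\<lambda>k. x (Suc k) + (x 0 / (1 - u 0)) * u (Suc k))" for x
  have "ip n (F x) (F y) = ip (Suc n) x y"
    if x: "ip (Suc n) x w = 0" and y: "ip (Suc n) y w = 0" for x y
  proof -
    have xu: "ip (Suc n) x u = 0" "ip (Suc n) y u = 0" using x y by (simp_all add: u_def ip_linear)
    define a where "a = x 0 / (1 - u 0)"
    define b where "b = y 0 / (1 - u 0)"
    have ab: "x 0 = a * (1 - u 0)" "y 0 = b * (1 - u 0)" using u0 by (auto simp: a_def b_def)
    have xt: "ip n (\<lambda>k. x (Suc k)) (\<lambda>k. u (Suc k)) = - (x 0 * u 0)"
      and yt: "ip n (\<lambda>k. u (Suc k)) (\<lambda>k. y (Suc k)) = - (y 0 * u 0)"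
      and ut: "ip n (\<lambda>k. u (Suc k)) (\<lambda>k. u (Suc k)) = 1 - u 0 * u 0"
      using xu uu shift[of x u] shift[of u y] shift[of u u] ip_commute[of "Suc n" y u] 
      by (auto simp: algebra_simps)
    have "ip n (F x) (F y) = ip n (\<lambda>k. x (Suc k)) (\<lambda>k. y (Suc k))
        - b * (x 0 * u 0) - a * (y 0 * u 0) + a * b * (1 - u 0 * u 0)"
      unfolding F_def a_def[symmetric] b_def[symmetric]
      by (simp add: ip_linear xt yt ut algebra_simps)
    also have "\<dots> = ip (Suc n) x y" unfolding shift[of x y] ab by (simp add: algebra_simps)
    finally show ?thesis .
  qed
  thus ?thesis by blast
qed

lemma drop_orthogonal_family:
  assumes "\<And>i. i < m \<Longrightarrow> ip d (w i) (w i) > 0"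
    and "\<And>i j. i < m \<Longrightarrow> j < m \<Longrightarrow> i \<noteq> j \<Longrightarrow> ip d (w i) (w j) = 0"
  shows "\<exists>F. \<forall>x y. (\<forall>i<m. ip d x (w i) = 0) \<longrightarrow> (\<forall>i<m. ip d y (w i) = 0) \<longrightarrow>
           ip (d - m) (F x) (F y) = ip d x y"
  using assms
proof (induction m arbitrary: d w)
  case 0
  show ?case by (intro exI[of _ "\<lambda>x. x"]) simp
next
  case (Suc m)
  have w0: "ip d (w 0) (w 0) > 0" by (rule Suc.prems) simp
  then obtain n where d: "d = Suc n" by (cases d) (auto simp: ip_def)
  obtain F where F: "ip n (F x) (F y) = ip d x y"
    if "ip d x (w 0) = 0" "ip d y (w 0) = 0" for x y
    using drop_dimension[of n "w 0"] w0 unfolding d by blast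
  have wS: "ip d (w (Suc i)) (w 0) = 0" if "i < m" for i using Suc.prems(2) that by simp
  have pos: "ip n (F (w (Suc i))) (F (w (Suc i))) > 0" if "i < m" for i
    using F[OF wS[OF that] wS[OF that]] Suc.prems(1)[of "Suc i"] that by simp
  have orth: "ip n (F (w (Suc i))) (F (w (Suc j))) = 0" if "i < m" "j < m" "i \<noteq> j" for i j
    using F[OF wS[OF that(1)] wS[OF that(2)]] Suc.prems(2)[of "Suc i" "Suc j"] that by simp
  have "\<exists>G. \<forall>x y. (\<forall>i<m. ip n x (F (w (Suc i))) = 0) \<longrightarrow> (\<forall>i<m. ip n y (F (w (Suc i))) = 0) \<longrightarrow>
           ip (n - m) (G x) (G y) = ip n x y"
    using pos orth by (rule Suc.IH)
  then obtain G where G: "ip (n - m) (G x) (G y) = ip n x y"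
    if "\<forall>i<m. ip n x (F (w (Suc i))) = 0" "\<forall>i<m. ip n y (F (w (Suc i))) = 0" for x y
    by metis
  have "ip (d - Suc m) (G (F x)) (G (F y)) = ip d x y"
    if "\<forall>i<Suc m. ip d x (w i) = 0" "\<forall>i<Suc m. ip d y (w i) = 0" for x y
    using that G[of "F x" "F y"] F wS by (simp add: d)
  thus ?case by (intro exI[of _ "\<lambda>x. G (F x)"]) blast
qed

lemma family_card_le_max_two_distance:
  assumes unit: "\<And>x. x \<in> I \<Longrightarrow> ip d (e x) (e x) = 1"
    and two: "\<And>x y. x \<in> I \<Longrightarrow> y \<in> I \<Longrightarrow> x \<noteq> y \<Longrightarrow> ip d (e x) (e y) \<in> {a, b}"
    and "a \<noteq> 1" "b \<noteq> 1"
  shows "card I \<le> max_two_distance d a b"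
proof -
  define v where "v x = vec d (e x)" for x
  have v: "v x \<bullet> v y = ip d (e x) (e y)" for x y
    by (simp add: v_def ip_def scalar_prod_def atLeast0LessThan)
  have "inj_on v I"
  proof (rule inj_onI, rule ccontr)
    fix x y assume "x \<in> I" "y \<in> I" "v x = v y" "x \<noteq> y"
    thus False using two[of x y] unit[of x] v[of x y] v[of x x] assms(3,4) by auto
  qed
  moreover have "spherical_two_distance d a b (v ` I)"
    using unit two by (auto simp: spherical_two_distance_def v) (auto simp: v_def)
  ultimately show ?thesis using card_le_max_two_distance card_image by metis
qed

section \<open>Signed vectors of an equiangular set\<close>

text \<open>
  An equiangular set represents lines, so each vector may be replaced by its negative; \<open>signed X\<close>
  contains both unit vectors of every line.
\<close>

definition signed :: "real vec set \<Rightarrow> real vec set" where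
  "signed X = X \<union> uminus ` X"

lemma mem_signed_iff: "y \<in> signed X \<longleftrightarrow> y \<in> X \<or> - y \<in> X"
  by (force simp: signed_def image_iff)

lemma signed_carrier: "equiangular r \<alpha> X \<Longrightarrow> y \<in> signed X \<Longrightarrow> y \<in> carrier_vec r"
  by (auto simp: signed_def equiangular_def)

lemma signed_unit: "equiangular r \<alpha> X \<Longrightarrow> y \<in> signed X \<Longrightarrow> y \<bullet> y = 1"
  by (auto simp: signed_def equiangular_def)

lemma signed_inner:
  assumes X: "equiangular r \<alpha> X" and yz: "y \<in> signed X" "z \<in> signed X" "y \<noteq> z" "y \<noteq> - z"
  shows "y \<bullet> z = \<alpha> \<or> y \<bullet> z = -\<alpha>"
proof -
  define b where "b x = (if x \<in> X then x else - x)" for x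
  have b: "b y \<in> X" "b z \<in> X" using yz(1,2) by (auto simp: b_def mem_signed_iff)
  have ne: "b y \<noteq> b z" using yz(3,4) by (auto simp: b_def)
  have "y \<in> carrier_vec r" "z \<in> carrier_vec r" using signed_carrier[OF X] yz by auto
  hence "b y \<bullet> b z = y \<bullet> z \<or> b y \<bullet> b z = - (y \<bullet> z)" by (auto simp: b_def)
  moreover have "b y \<bullet> b z = \<alpha> \<or> b y \<bullet> b z = -\<alpha>"
    using X b ne by (auto simp: equiangular_def)
  ultimately show ?thesis by auto
qed

lemma equiangular_no_antipode:
  assumes "equiangular r \<alpha> X" "x \<in> X"
  shows "- x \<notin> X"
proof
  assume "- x \<in> X"
  moreover have "x \<in> carrier_vec r" "x \<bullet> x = 1" "0 \<le> \<alpha>" "\<alpha> < 1"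
    using assms by (auto simp: equiangular_def)
  moreover have "x \<noteq> - x"
  proof
    assume "x = - x"
    hence "x \<bullet> x = - x \<bullet> x" by simp
    thus False using \<open>x \<in> carrier_vec r\<close> \<open>x \<bullet> x = 1\<close> by simp
  qed
  ultimately show False using assms by (force simp: equiangular_def)
qed

lemma finite_signed: "equiangular r \<alpha> X \<Longrightarrow> finite (signed X)"
  by (simp add: signed_def equiangular_def)

text \<open>
  Since \<open>X\<close> has only one of the two unit vectors on each line, choosing for every counted line the
  vector that lies in \<open>P\<close> is injective.
\<close>

lemma card_represented_le:
  assumes X: "equiangular r \<alpha> X" and P: "finite P"
  shows "card {x \<in> X. x \<in> P \<or> - x \<in> P} \<le> card P"
proof (rule card_inj_on_le[OF _ _ P])
  define f where "f x = (if x \<in> P then x else - x)" for x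
  show "inj_on f {x \<in> X. x \<in> P \<or> - x \<in> P}"
  proof (rule inj_onI)
    fix x y assume xy: "x \<in> {x \<in> X. x \<in> P \<or> - x \<in> P}" "y \<in> {x \<in> X. x \<in> P \<or> - x \<in> P}" "f x = f y"
    hence "x = y \<or> x = - y" unfolding f_def by (metis uminus_uminus_vec)
    thus "x = y" using xy equiangular_no_antipode[OF X] by auto
  qed
  show "f ` {x \<in> X. x \<in> P \<or> - x \<in> P} \<subseteq> P" by (auto simp: f_def)
qed

text \<open>
  The sign matrix of the equivalence of Gram matrices amounts to the choice of a unit vector on each
  line, and the permutation matrix to the order of the vectors, so that the base size is the largest
  size of such a set \<open>W\<close>.
\<close>

lemma obtuse_card_le_base_size:
  assumes X: "equiangular r \<alpha> X" and W: "W \<subseteq> signed X"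
    and obtuse: "\<And>x y. x \<in> W \<Longrightarrow> y \<in> W \<Longrightarrow> x \<noteq> y \<Longrightarrow> x \<bullet> y = -\<alpha>"
  shows "card W \<le> base_size \<alpha> X"
proof -
  have "finite W" using W finite_signed[OF X] finite_subset by blast
  then obtain ws where ws: "set ws = W" "distinct ws" using finite_distinct_list by blast
  define k where "k = length ws"
  have k: "card W = k" using ws distinct_card by (auto simp: k_def)
  define b :: "nat \<Rightarrow> real" where "b i = (if ws ! i \<in> X then 1 else -1)" for i
  define ps where "ps = map (\<lambda>w. if w \<in> X then w else - w) ws"
  have len: "length ps = k" by (simp add: ps_def k_def)
  have wsW: "ws ! i \<in> signed X" if "i < k" for i using that ws W by (auto simp: k_def)
  have sub: "set ps \<subseteq> X" using ws W by (auto simp: ps_def mem_signed_iff)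
  have entry: "b i * b j * (ps ! i \<bullet> ps ! j) = ws ! i \<bullet> ws ! j" if "i < k" "j < k" for i j
    using that signed_carrier[OF X wsW[OF that(1)]] signed_carrier[OF X wsW[OF that(2)]]
    by (auto simp: b_def ps_def k_def)
  have goal: "ws ! i \<bullet> ws ! j = (if i = j then 1 else -\<alpha>)" if "i < k" "j < k" for i j
    using that obtuse[of "ws ! i" "ws ! j"] signed_unit[OF X wsW[OF that(1)]] ws
    by (auto simp: k_def nth_eq_iff_index_eq)
  define C :: "real mat" where "C = mat k k (\<lambda>(i, j). if i = id j then 1 else 0)"
  have G: "gram ps \<in> carrier_mat k k" by (simp add: gram_def len)
  have "(1 + \<alpha>) \<cdot>\<^sub>m 1\<^sub>m k - \<alpha> \<cdot>\<^sub>m all_ones_mat k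
      = transpose_mat (C * mat_diag k b) * gram ps * (C * mat_diag k b)" (is "?L = ?R")
  proof (rule eq_matI)
    show dim: "dim_row ?L = dim_row ?R" "dim_col ?L = dim_col ?R"
      by (auto simp: C_def all_ones_mat_def mat_diag_def)
    fix i j assume "i < dim_row ?R" "j < dim_col ?R"
    hence ij: "i < k" "j < k" using dim by (auto simp: all_ones_mat_def)
    have "?R $$ (i, j) = b i * b j * gram ps $$ (i, j)"
      using signed_permuted_entry[OF G permutes_id ij C_def, of b] by simp
    also have "\<dots> = (if i = j then 1 else -\<alpha>)"
      using entry[OF ij] goal[OF ij] ij by (simp add: gram_def len)
    finally show "?L $$ (i, j) = ?R $$ (i, j)" using ij by (simp add: all_ones_mat_def)
  qed
  moreover have "\<forall>i<k. b i \<in> {-1, 1}" by (simp add: b_def)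
  hence "mat_diag k b \<in> sign_mats k" unfolding sign_mats_def by blast
  moreover have "transpose_mat (C * mat_diag k b) * gram ps * (C * mat_diag k b) \<in> carrier_mat k k"
  proof -
    have "C * mat_diag k b \<in> carrier_mat k k"
      by (rule mult_carrier_mat[of _ k k]) (simp_all add: C_def)
    thus ?thesis using G by (metis mult_carrier_mat transpose_carrier_mat)
  qed
  moreover have "C \<in> permutation_mats k"
    unfolding permutation_mats_def C_def using permutes_id by blast
  ultimately have "gram ps \<simeq>\<^sub>G (1 + \<alpha>) \<cdot>\<^sub>m 1\<^sub>m k - \<alpha> \<cdot>\<^sub>m all_ones_mat k"
    unfolding gram_equiv_def using G
    by (intro exI[of _ k] conjI bexI) auto
  thus ?thesis unfolding base_size_def k
    using len sub by (intro Max_ge finite_base_sizes[OF X]) blast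
qed

lemma base_size_attained:
  assumes X: "equiangular r \<alpha> X" and k: "base_size \<alpha> X = k"
  obtains q where "\<And>i. i < k \<Longrightarrow> q i \<in> signed X"
    and "\<And>i j. i < k \<Longrightarrow> j < k \<Longrightarrow> i \<noteq> j \<Longrightarrow> q i \<bullet> q j = -\<alpha>"
proof -
  let ?K = "{k. \<exists>ps. length ps = k \<and> set ps \<subseteq> X \<and>
            gram ps \<simeq>\<^sub>G (1 + \<alpha>) \<cdot>\<^sub>m 1\<^sub>m k - \<alpha> \<cdot>\<^sub>m all_ones_mat k}"
  have "k \<in> ?K" using Max_in[OF finite_base_sizes[OF X]] zero_base_size[of X \<alpha>]
    unfolding k[symmetric] base_size_def by blast
  then obtain ps where ps: "length ps = k" "set ps \<subseteq> X"
      and e: "gram ps \<simeq>\<^sub>G (1 + \<alpha>) \<cdot>\<^sub>m 1\<^sub>m k - \<alpha> \<cdot>\<^sub>m all_ones_mat k" by blast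
  obtain b \<pi> where b: "\<forall>i<k. b i \<in> {-1, 1}" and p: "\<pi> permutes {..<k}"
    and eq: "(1 + \<alpha>) \<cdot>\<^sub>m 1\<^sub>m k - \<alpha> \<cdot>\<^sub>m all_ones_mat k
      = transpose_mat (mat k k (\<lambda>(i, j). if i = \<pi> j then 1 else 0) * mat_diag k b) * gram ps *
        (mat k k (\<lambda>(i, j). if i = \<pi> j then 1 else 0) * mat_diag k b)"
    using e ps(1) unfolding gram_equiv_def sign_mats_def permutation_mats_def
    by (auto simp: gram_def)
  have \<pi>: "\<pi> i < k" if "i < k" for i using permutes_in_image[OF p] that by auto
  have entry: "- \<alpha> = b i * b j * (ps ! \<pi> i \<bullet> ps ! \<pi> j)" if ij: "i < k" "j < k" "i \<noteq> j" for i j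
    using arg_cong[OF eq, of "\<lambda>M. M $$ (i, j)"] ij ps(1) \<pi>
      signed_permuted_entry[OF _ p ij(1,2) refl, of "gram ps" b]
    by (simp add: gram_def all_ones_mat_def)
  define q where "q i = (if b i = 1 then ps ! \<pi> i else - (ps ! \<pi> i))" for i
  have psX: "ps ! \<pi> i \<in> X" if "i < k" for i using \<pi>[OF that] ps by auto
  have carr: "ps ! \<pi> i \<in> carrier_vec r" if "i < k" for i
    using psX[OF that] X by (auto simp: equiangular_def)
  show ?thesis
  proof
    show "q i \<in> signed X" if "i < k" for i using psX[OF that] by (auto simp: q_def mem_signed_iff)
    show "q i \<bullet> q j = -\<alpha>" if "i < k" "j < k" "i \<noteq> j" for i j
      using entry[OF that] b[rule_format, OF that(1)] b[rule_format, OF that(2)]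
        carr[OF that(1)] carr[OF that(2)] by (auto simp: q_def)
  qed
qed

section \<open>Pillars over a base of four vectors\<close>

lemma less4: "i < 4 \<longleftrightarrow> i = 0 \<or> i = 1 \<or> i = 2 \<or> i = (3::nat)"
  by auto

lemma sum4: "(\<Sum>i<4. f i) = f 0 + f 1 + f 2 + f (3::nat)"
  by (simp add: eval_nat_numeral)

lemma lessThan_4: "{..<4} = {0, 1, 2, 3::nat}"
  by auto

text \<open>
  The assumption \<open>obtuse_card\<close> is maximality of the base: no five signed vectors have all mutual
  inner products \<open>-1/5\<close>.
\<close>

locale base_of_four =
  fixes r :: nat and X :: "real vec set" and q :: "nat \<Rightarrow> real vec"
  assumes X: "equiangular r (1/5) X"
    and base: "\<And>i. i < 4 \<Longrightarrow> q i \<in> signed X"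
    and base_inner: "\<And>i j. i < 4 \<Longrightarrow> j < 4 \<Longrightarrow> i \<noteq> j \<Longrightarrow> q i \<bullet> q j = -1/5"
    and obtuse_card: "\<And>W. W \<subseteq> signed X \<Longrightarrow>
      (\<And>x y. x \<in> W \<Longrightarrow> y \<in> W \<Longrightarrow> x \<noteq> y \<Longrightarrow> x \<bullet> y = -1/5) \<Longrightarrow> card W \<le> 4"
begin

definition pillar :: "nat set \<Rightarrow> real vec set" where
  "pillar A = {y \<in> signed X. \<forall>i<4. y \<bullet> q i = (if i \<in> A then 1/5 else -1/5)}"

text \<open>
  The coordinates of the projection of \<open>y\<close> to the span of the base: the Gram matrix of the base is
  \<open>6/5 I - 1/5 J\<close>, its inverse is \<open>5/6 (I + J/2)\<close>, and this inverse is applied to the inner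
  products of \<open>y\<close> with the base vectors.
\<close>

definition coef :: "real vec \<Rightarrow> nat \<Rightarrow> real" where
  "coef y i = 5/6 * (y \<bullet> q i + (\<Sum>j<4. y \<bullet> q j) / 2)"

text \<open>The component of \<open>y\<close> orthogonal to the base.\<close>

definition perp :: "real vec \<Rightarrow> nat \<Rightarrow> real" where
  "perp y = (\<lambda>k. y $ k - (\<Sum>i<4. coef y i * q i $ k))"

lemma base_carrier: "i < 4 \<Longrightarrow> q i \<in> carrier_vec r"
  using signed_carrier[OF X base] .

lemma base_unit: "i < 4 \<Longrightarrow> q i \<bullet> q i = 1"
  using signed_unit[OF X base] .

lemma inj_base: "inj_on q {..<4}"
proof (rule inj_onI, rule ccontr)
  fix i j assume "i \<in> {..<4::nat}" "j \<in> {..<4}" "q i = q j" "i \<noteq> j"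
  thus False using base_inner[of i j] base_unit[of i] by auto
qed

lemma pillar_signed: "y \<in> pillar A \<Longrightarrow> y \<in> signed X"
  by (simp add: pillar_def)

lemma pillar_carrier: "y \<in> pillar A \<Longrightarrow> y \<in> carrier_vec r"
  using signed_carrier[OF X pillar_signed] .

lemma pillar_base: "y \<in> pillar A \<Longrightarrow> i < 4 \<Longrightarrow> y \<bullet> q i = (if i \<in> A then 1/5 else -1/5)"
  by (simp add: pillar_def)

lemma finite_pillar: "finite (pillar A)"
  using finite_signed[OF X] by (simp add: pillar_def)

lemma perp_orthogonal:
  assumes "y \<in> carrier_vec r" "i < 4"
  shows "ip r (perp y) (($) (q i)) = 0"
proof -
  have "q j \<bullet> q i = (if j = i then 1 else -1/5)" if "j < 4" for j
    using base_unit base_inner that assms(2) by auto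
  hence "ip r (perp y) (($) (q i)) = y \<bullet> q i - (\<Sum>j<4. coef y j * (if j = i then 1 else -1/5))"
    using base_carrier assms by (simp add: perp_def ip_linear ip_vec_index)
  also have "\<dots> = 0"
    using assms(2) by (auto simp: coef_def sum4 less4 field_simps)
  finally show ?thesis .
qed

lemma perp_inner:
  assumes y: "y \<in> carrier_vec r" and z: "z \<in> carrier_vec r"
  shows "ip r (perp y) (perp z) = y \<bullet> z
    - 5/6 * ((\<Sum>i<4. (y \<bullet> q i) * (z \<bullet> q i)) + (\<Sum>i<4. y \<bullet> q i) * (\<Sum>i<4. z \<bullet> q i) / 2)"
proof -
  have "ip r (perp y) (perp z) = ip r (perp y) (($) z)"
    unfolding perp_def[of z] using perp_orthogonal[OF y] by (simp add: ip_linear)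
  also have "\<dots> = y \<bullet> z - (\<Sum>i<4. coef y i * (z \<bullet> q i))"
    using z base_carrier comm_scalar_prod[OF z]
    by (simp add: perp_def ip_linear ip_vec_index)
  also have "(\<Sum>i<4. coef y i * (z \<bullet> q i))
      = 5/6 * ((\<Sum>i<4. (y \<bullet> q i) * (z \<bullet> q i)) + (\<Sum>i<4. y \<bullet> q i) * (\<Sum>i<4. z \<bullet> q i) / 2)"
    by (simp add: coef_def sum4 field_simps)
  finally show ?thesis .
qed

text \<open>
  A two-distance family orthogonal to the base lives in dimension \<open>r - 4\<close>. Reducing the dimension
  one vector at a time needs an orthogonal basis of the span of the base. The rows of the Hadamard
  matrix \<open>h\<close> of order four are its coefficient vectors: they are pairwise orthogonal, one is constant
  and the others sum to zero, so they are eigenvectors of the Gram matrix \<open>6/5 I - 1/5 J\<close> of the base.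
\<close>

lemma perp_family_card_le:
  assumes orth: "\<And>x i. x \<in> I \<Longrightarrow> i < 4 \<Longrightarrow> ip r (e x) (($) (q i)) = 0"
    and unit: "\<And>x. x \<in> I \<Longrightarrow> ip r (e x) (e x) = 1"
    and two: "\<And>x y. x \<in> I \<Longrightarrow> y \<in> I \<Longrightarrow> x \<noteq> y \<Longrightarrow> ip r (e x) (e y) \<in> {a, b}"
    and "a \<noteq> 1" "b \<noteq> 1"
  shows "card I \<le> max_two_distance (r - 4) a b"
proof -
  define p where "p i = ($) (q i)" for i
  have pp: "ip r (p i) (p j) = (if i = j then 1 else -1/5)" if "i < 4" "j < 4" for i j
    using that base_inner base_unit base_carrier by (auto simp: p_def ip_vec_index)
  define h :: "nat \<Rightarrow> nat \<Rightarrow> real" where "h i j = (if i = 0 \<or> j = 0 \<or> i = j then 1 else -1)" for i j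
  define w where "w i = (\<lambda>k. \<Sum>j<4. h i j * p j k)" for i
  have ww: "ip r (w i) (w j) = (if i = j then if i = 0 then 8/5 else 24/5 else 0)"
    if ij: "i < 4" "j < 4" for i j
  proof -
    have "ip r (w i) (w j) = (\<Sum>k<4. h i k * (\<Sum>l<4. h j l * ip r (p k) (p l)))"
      by (simp add: w_def ip_linear_left) (simp add: ip_linear_right)
    also have "\<dots> = (\<Sum>k<4. h i k * (\<Sum>l<4. h j l * (if k = l then 1 else -1/5)))"
      using pp by (intro sum.cong arg_cong2[of _ _ _ _ times] refl) auto
    also have "\<dots> = (if i = j then if i = 0 then 8/5 else 24/5 else 0)"
      using ij unfolding less4 by (elim disjE) (simp_all add: sum4 h_def)
    finally show ?thesis .
  qed
  have pos: "ip r (w i) (w i) > 0" if "i < 4" for i using ww[OF that that] by simp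
  have orthw: "ip r (w i) (w j) = 0" if "i < 4" "j < 4" "i \<noteq> j" for i j using ww that by simp
  obtain F where F: "\<forall>x y. (\<forall>i<4. ip r x (w i) = 0) \<longrightarrow> (\<forall>i<4. ip r y (w i) = 0) \<longrightarrow>
           ip (r - 4) (F x) (F y) = ip r x y"
    using drop_orthogonal_family[of 4 r w] pos orthw by blast
  have ew: "ip r (e x) (w i) = 0" if "x \<in> I" for x i
    using orth[OF that] by (simp add: w_def p_def ip_linear)
  have Fe: "ip (r - 4) (F (e x)) (F (e y)) = ip r (e x) (e y)" if "x \<in> I" "y \<in> I" for x y
    using F ew that by blast
  show ?thesis
    by (rule family_card_le_max_two_distance[of I "r - 4" "\<lambda>x. F (e x)"])
      (use unit two Fe assms(4,5) in auto)
qed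

lemma pillar_not_antipodal:
  assumes "y \<in> pillar A" "z \<in> pillar B" "A \<subseteq> {..<4}" "B \<subseteq> {..<4}" 
    and "y = - z"
  shows "B = {..<4} - A"
proof -
  have "i \<in> A \<longleftrightarrow> i \<notin> B" if "i < 4" for i
    using pillar_base[OF assms(1) that] pillar_base[OF assms(2) that] assms(5)
      base_carrier[OF that] pillar_carrier[OF assms(2)] by (auto split: if_splits)
  thus ?thesis using assms(3,4) by auto
qed

lemma pillar_disjoint:
  assumes "y \<in> pillar A" "y \<in> pillar B" "A \<subseteq> {..<4}" "B \<subseteq> {..<4}"
  shows "A = B"
proof -
  have "i \<in> A \<longleftrightarrow> i \<in> B" if "i < 4" for i
    using pillar_base[OF assms(1) that] pillar_base[OF assms(2) that] by (auto split: if_splits)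
  thus ?thesis using assms(3,4) by auto
qed

lemma pillar_inner:
  assumes "y \<in> pillar A" "z \<in> pillar B" "A \<subseteq> {..<4}" "B \<subseteq> {..<4}" "y \<noteq> z" "B \<noteq> {..<4} - A"
  shows "y \<bullet> z = 1/5 \<or> y \<bullet> z = -1/5"
  using signed_inner[OF X pillar_signed[OF assms(1)] pillar_signed[OF assms(2)] assms(5)]
    pillar_not_antipodal[OF assms(1-4)] assms(6) by auto

lemma pillar_empty: "pillar {} = {}"
proof (rule ccontr)
  assume "pillar {} \<noteq> {}"
  then obtain y where y: "y \<in> pillar {}" by blast
  have yq: "y \<bullet> q i = -1/5" "q i \<bullet> y = -1/5" if "i < 4" for i
    using pillar_base[OF y that] comm_scalar_prod[OF pillar_carrier[OF y] base_carrier[OF that]]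
    by auto
  have notin: "y \<notin> q ` {..<4}"
    using yq signed_unit[OF X pillar_signed[OF y]] by force
  have "card (insert y (q ` {..<4})) \<le> 4"
  proof (rule obtuse_card)
    show "insert y (q ` {..<4}) \<subseteq> signed X" using y base by (auto simp: pillar_signed)
    have "q i \<bullet> q j = -1/5" if "i < 4" "j < 4" "q i \<noteq> q j" for i j
      using base_inner[of i j] that by auto
    thus "x \<bullet> x' = -1/5" if "x \<in> insert y (q ` {..<4})" "x' \<in> insert y (q ` {..<4})" "x \<noteq> x'"
      for x x'
      using that yq by auto
  qed
  thus False using notin card_image[OF inj_base] by simp
qed

text \<open>
  Otherwise \<open>y\<close>, \<open>z\<close> and the three base vectors other than \<open>q i\<close> would be five signed vectors with
  mutual inner products \<open>-1/5\<close>.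
\<close>

lemma singleton_pillar_inner:
  assumes i: "i < 4" and yz: "y \<in> pillar {i}" "z \<in> pillar {i}" "y \<noteq> z"
  shows "y \<bullet> z = 1/5"
proof (rule ccontr)
  assume "y \<bullet> z \<noteq> 1/5"
  moreover have "{i} \<noteq> {..<4} - {i}" by auto
  ultimately have yz': "y \<bullet> z = -1/5" "z \<bullet> y = -1/5"
    using pillar_inner[OF yz(1,2) _ _ yz(3)] i
      comm_scalar_prod[OF pillar_carrier[OF yz(1)] pillar_carrier[OF yz(2)]] by auto
  define Q where "Q = q ` ({..<4} - {i})"
  have uq: "u \<bullet> x = -1/5" "x \<bullet> u = -1/5" if u': "u \<in> {y, z}" and x: "x \<in> Q" for u x
  proof -
    have u: "u \<in> pillar {i}" using u' yz by auto
    obtain j where j: "x = q j" "j < 4" "j \<noteq> i" using x unfolding Q_def by blast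
    show "u \<bullet> x = -1/5" using pillar_base[OF u j(2)] j by simp
    thus "x \<bullet> u = -1/5"
      using comm_scalar_prod[OF pillar_carrier[OF u] base_carrier[OF j(2)]] j by simp
  qed
  have QQ: "x \<bullet> x' = -1/5" if "x \<in> Q" "x' \<in> Q" "x \<noteq> x'" for x x'
    using that base_inner by (auto simp: Q_def)
  have "y \<bullet> y = 1" "z \<bullet> z = 1" using signed_unit[OF X pillar_signed] yz by auto
  hence notin: "y \<notin> Q" "z \<notin> Q" using uq[of y y] uq[of z z] by auto
  have "card Q = card ({..<4} - {i})"
    unfolding Q_def by (rule card_image) (rule inj_on_subset[OF inj_base], auto)
  also have "\<dots> = 3" using i by simp
  finally have "card Q = 3" .
  moreover have "finite Q" by (simp add: Q_def)
  ultimately have "card (insert y (insert z Q)) = 5" using notin yz(3) by simp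
  moreover have "card (insert y (insert z Q)) \<le> 4"
  proof (rule obtuse_card)
    show "insert y (insert z Q) \<subseteq> signed X"
      using yz base by (auto simp: pillar_signed Q_def)
  qed (use yz' uq QQ in auto)
  ultimately show False by simp
qed

text \<open>
  With \<open>y \<bullet> z = 1/5\<close> inside the pillar and a component of squared norm \<open>1/5\<close> along the base, the
  perpendicular parts are orthogonal to each other.
\<close>

lemma perp_inner_singleton:
  assumes i: "i < 4" and yz: "y \<in> pillar {i}" "z \<in> pillar {i}"
  shows "ip r (perp y) (perp z) = (if y = z then 4/5 else 0)"
  using i singleton_pillar_inner[OF assms] signed_unit[OF X pillar_signed[OF yz(1)]]
  unfolding less4
  by (auto simp: perp_inner[OF pillar_carrier[OF yz(1)] pillar_carrier[OF yz(2)]]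
      pillar_base[OF yz(1)] pillar_base[OF yz(2)] sum4)

lemma perp_inner_two_singletons:
  assumes ij: "i < 4" "j < 4" "i \<noteq> j" and yz: "y \<in> pillar {i}" "z \<in> pillar {j}"
  shows "ip r (perp y) (perp z) \<in> {2/15, -4/15}"
proof -
  have "y \<noteq> z" using pillar_disjoint[of y "{i}" "{j}"] yz ij by auto
  moreover have "{j} \<noteq> {..<4} - {i}"
  proof
    assume "{j} = {..<4} - {i}"
    hence "card {j} = card ({..<4} - {i})" by simp
    thus False using ij by simp
  qed
  ultimately have "y \<bullet> z = 1/5 \<or> y \<bullet> z = -1/5"
    using pillar_inner[OF yz] ij by auto
  thus ?thesis using ij unfolding less4
    by (elim disjE) (simp_all add: perp_inner[OF pillar_carrier[OF yz(1)] pillar_carrier[OF yz(2)]]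
      pillar_base[OF yz(1)] pillar_base[OF yz(2)] sum4)
qed

lemma perp_inner_pair:
  assumes j: "j \<in> {1,2,3}" and yz: "y \<in> pillar {0, j}" "z \<in> pillar {0, j}"
  shows "ip r (perp y) (perp z) = y \<bullet> z - 2/15"
  using j
  by (auto simp: perp_inner[OF pillar_carrier[OF yz(1)] pillar_carrier[OF yz(2)]]
      pillar_base[OF yz(1)] pillar_base[OF yz(2)] sum4)

lemma perp_inner_singleton_pair:
  assumes i: "i < 4" and j: "j \<in> {1,2,3}" and yz: "y \<in> pillar {i}" "z \<in> pillar {0, j}"
  shows "4/225 \<le> (ip r (perp y) (perp z))\<^sup>2"
proof -
  have card: "card {0, j} = 2" using j by auto
  have "y \<noteq> z"
  proof
    assume "y = z"
    hence "{i} = {0, j}" using pillar_disjoint[of y "{i}" "{0, j}"] yz i j by auto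
    thus False using card by (metis card.empty card_insert_disjoint empty_iff finite.emptyI n_not_Suc_n numeral_2_eq_2)
  qed
  moreover have "{0, j} \<noteq> {..<4} - {i}"
  proof
    assume "{0, j} = {..<4} - {i}"
    hence "card {0, j} = card ({..<4} - {i})" by simp
    thus False using i card by simp
  qed
  ultimately have "y \<bullet> z = 1/5 \<or> y \<bullet> z = -1/5"
    using pillar_inner[OF yz] i j by auto
  moreover have "ip r (perp y) (perp z) = y \<bullet> z - (if i \<in> {0, j} then 1/15 else -1/15)"
    using i j unfolding less4
    by (elim disjE; simp; elim disjE)
      (simp_all add: perp_inner[OF pillar_carrier[OF yz(1)] pillar_carrier[OF yz(2)]]
      pillar_base[OF yz(1)] pillar_base[OF yz(2)] sum4)
  ultimately have "\<bar>ip r (perp y) (perp z)\<bar> \<ge> 2/15" by auto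
  hence "(2/15)\<^sup>2 \<le> (ip r (perp y) (perp z))\<^sup>2" by (subst abs_le_square_iff[symmetric]) simp
  thus ?thesis by (simp add: power2_eq_square)
qed

section \<open>Sizes of the pillars\<close>

text \<open>
  The perpendicular parts have squared norm \<open>13/15\<close> and mutual inner products \<open>1/5 - 2/15 = 1/15\<close>
  or \<open>-1/5 - 2/15 = -5/15\<close>; scaling them to unit length gives the two distances in question.
\<close>

lemma card_pair_pillar_le:
  assumes j: "j \<in> {1,2,3}"
  shows "card (pillar {0, j}) \<le> max_two_distance (r - 4) (1/13) (-5/13)"
proof (rule perp_family_card_le[where e = "\<lambda>y k. sqrt (15/13) * perp y k"])
  have [simp]: "sqrt (15/13) * (sqrt (15/13) * t) = 15/13 * t" for t
    by (simp flip: mult.assoc)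
  have "{0, j} \<noteq> {..<4} - {0, j}" by auto
  fix y z assume y: "y \<in> pillar {0, j}"
  show "ip r (\<lambda>k. sqrt (15/13) * perp y k) (($) (q i)) = 0" if "i < 4" for i
    using perp_orthogonal[OF pillar_carrier[OF y] that] by (simp add: ip_linear)
  show "ip r (\<lambda>k. sqrt (15/13) * perp y k) (\<lambda>k. sqrt (15/13) * perp y k) = 1"
    using perp_inner_pair[OF j y y] signed_unit[OF X pillar_signed[OF y]] by (simp add: ip_linear)
  assume z: "z \<in> pillar {0, j}" and "y \<noteq> z"
  hence "y \<bullet> z = 1/5 \<or> y \<bullet> z = -1/5"
    using pillar_inner[OF y z] j \<open>{0, j} \<noteq> {..<4} - {0, j}\<close> by auto
  thus "ip r (\<lambda>k. sqrt (15/13) * perp y k) (\<lambda>k. sqrt (15/13) * perp z k) \<in> {1/13, -5/13}"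
    using perp_inner_pair[OF j y z] by (auto simp: ip_linear)
qed auto

lemma card_two_singleton_pillars_le:
  assumes ij: "i < 4" "j < 4" "i \<noteq> j" and ne: "pillar {i} \<noteq> {}" "pillar {j} \<noteq> {}"
  shows "card (pillar {i}) + card (pillar {j}) \<le> 48"
proof -
  have *: "card (pillar {i}) + card (pillar {j}) \<le> 48"
    if "i < 4" "j < 4" "i \<noteq> j" "pillar {i} \<noteq> {}" "card (pillar {i}) \<le> card (pillar {j})" for i j
    using perp_inner_singleton[OF that(1)] perp_inner_singleton[OF that(2)]
      perp_inner_two_singletons[OF that(1-3)]
    by (intro orthogonal_pair_card_le[OF finite_pillar that(4) finite_pillar that(5),
          of r perp perp]) auto
  show ?thesis using *[of i j] *[of j i] assms by linarith
qed

text \<open>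
  A vector of a pair pillar has inner products of absolute value at least \<open>2/15\<close> with all members of
  the orthogonal family that comes from \<open>pillar {i}\<close>, so Bessel leaves room for at most
  \<open>(4/5) (13/15) / (4/225) = 39\<close> of them.
\<close>

lemma card_singleton_pillar_le_39:
  assumes i: "i < 4" and j: "j \<in> {1,2,3}" and ne: "pillar {0, j} \<noteq> {}"
  shows "card (pillar {i}) \<le> 39"
proof -
  obtain z where z: "z \<in> pillar {0, j}" using ne by blast
  have "real (card (pillar {i})) * (4/225) = (\<Sum>y\<in>pillar {i}. 4/225)" by simp
  also have "\<dots> \<le> (\<Sum>y\<in>pillar {i}. (ip r (perp y) (perp z))\<^sup>2)"
    using perp_inner_singleton_pair[OF i j _ z] by (intro sum_mono)
  also have "\<dots> \<le> 4/5 * ip r (perp z) (perp z)"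
    by (rule bessel[OF finite_pillar]) (simp_all add: perp_inner_singleton[OF i])
  also have "\<dots> = 4/5 * (13/15)"
    using perp_inner_pair[OF j z z] signed_unit[OF X pillar_signed[OF z]] by simp
  finally show ?thesis by simp
qed

text \<open>
  An orthogonal family spreads to a family with constant inner product \<open>1/13\<close> in the same span, by
  adding a suitable multiple of the sum of the family to each member. So an orthogonal family is no
  larger than a two-distance set, even if the distance \<open>-5/13\<close> does not occur.
\<close>

lemma card_singleton_pillar_le:
  assumes i: "i < 4"
  shows "card (pillar {i}) \<le> max_two_distance (r - 4) (1/13) (-5/13)"
proof (cases "pillar {i} = {}")
  case True
  thus ?thesis by simp
next
  case False
  define P where "P = pillar {i}"
  define n where "n = real (card P)"
  have P: "finite P" by (simp add: P_def finite_pillar)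
  have n: "n > 0" using False P by (simp add: n_def P_def card_gt_0_iff)
  \<comment> \<open>\<open>a\<close> and \<open>b\<close> solve the equations \<open>4/5 (a\<^sup>2 + 2 a b + n b\<^sup>2) = 1\<close> and \<open>4/5 (2 a b + n b\<^sup>2) = 1/13\<close>.\<close>
  define a where "a = sqrt (15/13)"
  define b where "b = (sqrt (15/13 + n * (5/52)) - a) / n"
  have aa: "a * a = 15/13" by (simp add: a_def)
  have "(n * b + a) * (n * b + a) = 15/13 + n * (5/52)"
    using n by (simp add: b_def)
  hence "n * (2 * a * b + n * b * b) = n * (5/52)" using aa by (simp add: algebra_simps)
  hence ab: "2 * a * b + n * b * b = 5/52" using n by simp
  define S where "S = (\<lambda>k. \<Sum>y\<in>P. perp y k)"
  define e where "e y = (\<lambda>k. a * perp y k + b * S k)" for y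
  have S1: "ip r (perp y) S = 4/5" if "y \<in> P" for y
  proof -
    have "ip r (perp y) S = (\<Sum>z\<in>P. if y = z then 4/5 else 0)"
      unfolding S_def ip_linear using that
      by (intro sum.cong) (auto simp: P_def perp_inner_singleton[OF i])
    thus ?thesis using that P by simp
  qed
  have S1': "ip r S (perp y) = 4/5" if "y \<in> P" for y
    using S1[OF that] by (simp only: ip_commute)
  have "ip r S S = (\<Sum>y\<in>P. ip r (perp y) S)" unfolding S_def ip_linear_left ..
  also have "\<dots> = (\<Sum>y\<in>P. 4/5)" using S1 by (rule sum.cong[OF refl])
  finally have SS: "ip r S S = 4/5 * n" by (simp add: n_def)
  have ee: "ip r (e y) (e z) = (if y = z then 1 else 1/13)" if "y \<in> P" "z \<in> P" for y z
  proof -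
    have "ip r (e y) (e z) = a * a * ip r (perp y) (perp z) + 4/5 * (2 * a * b + n * b * b)"
      using that by (simp add: e_def ip_linear S1 S1' SS algebra_simps)
    thus ?thesis using that by (simp add: ab aa P_def perp_inner_singleton[OF i])
  qed
  show ?thesis
  proof (rule perp_family_card_le[where e = e])
    fix y k assume y: "y \<in> pillar {i}" "k < (4::nat)"
    show "ip r (e y) (($) (q k)) = 0"
      using perp_orthogonal[OF pillar_carrier y(2)] y(1)
      by (simp add: e_def S_def ip_linear P_def)
  qed (simp_all add: ee flip: P_def)
qed

text \<open>
  The signs of the inner products with the base place every other line in a pillar. A line has two
  unit vectors with complementary sign patterns, so of the sixteen patterns eight remain: the empty
  one, whose pillar is empty, four singletons, and the pairs that contain \<open>0\<close>.
\<close>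

lemma card_le_sum_pillars:
  "card X \<le> 4 + (\<Sum>i<4. card (pillar {i})) + (\<Sum>j\<in>{1,2,3}. card (pillar {0, j}))"
proof -
  define R where "R P = {x \<in> X. x \<in> P \<or> - x \<in> P}" for P
  have R: "card (R P) \<le> card P" if "finite P" for P
    unfolding R_def by (rule card_represented_le[OF X that])
  have cover: "X \<subseteq> R (q ` {..<4}) \<union> (\<Union>i<4. R (pillar {i})) \<union> (\<Union>j\<in>{1,2,3}. R (pillar {0, j}))"
  proof
    fix x assume x: "x \<in> X"
    have sx: "x \<in> signed X" "- x \<in> signed X" using x by (auto simp: mem_signed_iff)
    show "x \<in> R (q ` {..<4}) \<union> (\<Union>i<4. R (pillar {i})) \<union> (\<Union>j\<in>{1,2,3}. R (pillar {0, j}))"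
    proof (cases "\<exists>i<4. x = q i \<or> x = - q i")
      case True
      hence "x \<in> R (q ` {..<4})" using x by (auto simp: R_def)
      thus ?thesis by blast
    next
      case False
      define A where "A = {i. i < 4 \<and> x \<bullet> q i = 1/5}"
      have val: "x \<bullet> q i = (if i \<in> A then 1/5 else -1/5)" if "i < 4" for i
        using signed_inner[OF X sx(1) base[OF that]] False that by (auto simp: A_def)
      have xA: "x \<in> pillar A" using sx val by (simp add: pillar_def)
      have "- x \<bullet> q i = - (x \<bullet> q i)" if "i < 4" for i
        using signed_carrier[OF X sx(1)] base_carrier[OF that] by simp
      hence mxA: "- x \<in> pillar ({..<4} - A)" using sx val by (simp add: pillar_def)
      define \<B> where "\<B> = {{}, {0}, {1}, {2}, {3}, {0, 1}, {0, 2}, {0, 3::nat}}"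
      have "(\<lambda>B. {0, 1, 2, 3} - B) ` \<B> = {{0, 1, 2, 3}, {0, 2, 3}, {0, 1, 3}, {0, 1, 2}, {1, 2, 3},
          {1, 3}, {1, 2}, {2, 3}}"
        by (simp add: \<B>_def insert_Diff_if)
      hence "Pow {0, 1, 2, 3} \<subseteq> \<B> \<union> (\<lambda>B. {0, 1, 2, 3} - B) ` \<B>"
        by (simp add: \<B>_def Pow_insert)
      moreover have "A \<in> Pow {0, 1, 2, 3}" by (auto simp: A_def)
      ultimately have "A \<in> \<B> \<or> (\<exists>B\<in>\<B>. A = {..<4} - B)" unfolding lessThan_4 by blast
      moreover have "B \<subseteq> {..<4}" if "B \<in> \<B>" for B using that by (auto simp: \<B>_def)
      ultimately have "\<exists>B\<in>\<B>. x \<in> pillar B \<or> - x \<in> pillar B"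
        using xA mxA double_diff[OF _ subset_refl, of _ "{..<4}"] by metis
      hence "x \<in> R (pillar {}) \<or> (\<exists>i<4. x \<in> R (pillar {i})) \<or> (\<exists>j\<in>{1,2,3}. x \<in> R (pillar {0, j}))"
        using x unfolding R_def \<B>_def less4 by (simp; blast)
      thus ?thesis by (auto simp: pillar_empty R_def)
    qed
  qed
  have "finite X" using X by (simp add: equiangular_def)
  hence fR: "finite (R P)" for P by (simp add: R_def)
  have "card X \<le> card (R (q ` {..<4}) \<union> (\<Union>i<4. R (pillar {i})) \<union> (\<Union>j\<in>{1,2,3}. R (pillar {0, j})))"
    by (rule card_mono[OF _ cover]) (simp add: fR)
  also have "\<dots> \<le> card (R (q ` {..<4})) + card (\<Union>i<4. R (pillar {i}))
      + card (\<Union>j\<in>{1,2,3}. R (pillar {0, j}))"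
    by (meson add_le_mono1 card_Un_le le_trans)
  also have "\<dots> \<le> 4 + (\<Sum>i<4. card (pillar {i})) + (\<Sum>j\<in>{1,2,3}. card (pillar {0, j}))"
  proof (intro add_mono)
    show "card (R (q ` {..<4})) \<le> 4" using R[of "q ` {..<4}"] card_image[OF inj_base] by simp
    show "card (\<Union>i<4. R (pillar {i})) \<le> (\<Sum>i<4. card (pillar {i}))"
      by (rule order_trans[OF card_UN_le sum_mono]) (simp_all add: R finite_pillar)
    show "card (\<Union>j\<in>{1,2,3}. R (pillar {0, j})) \<le> (\<Sum>j\<in>{1,2,3}. card (pillar {0, j}))"
      by (rule order_trans[OF card_UN_le sum_mono]) (simp_all add: R finite_pillar)
  qed
  finally show ?thesis .
qed

lemma card_bound: "card X \<le> 100 + 3 * max_two_distance (r - 4) (1/13) (-5/13)"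
proof -
  define s where "s = max_two_distance (r - 4) (1/13) (-5/13)"
  define n where "n i = card (pillar {i})" for i
  define m where "m = (\<Sum>j\<in>{1,2,3::nat}. card (pillar {0, j}))"
  have X_le: "card X \<le> 4 + (\<Sum>i<4. n i) + m"
    using card_le_sum_pillars by (simp add: n_def m_def)
  have m_le: "m \<le> 3 * s"
    using sum_mono[of "{1,2,3}" "\<lambda>j. card (pillar {0, j})" "\<lambda>_. s"] card_pair_pillar_le
    by (simp add: m_def s_def)
  have two: "n i + n j \<le> 48" if "i < 4" "j < 4" "i \<noteq> j" "n i \<noteq> 0" "n j \<noteq> 0" for i j
    using card_two_singleton_pillars_le[of i j] that by (simp add: n_def card_gt_0_iff)
  show ?thesis
  proof (cases "\<exists>i<4. \<exists>j<4. i \<noteq> j \<and> n i \<noteq> 0 \<and> n j \<noteq> 0")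
    case True
    then obtain i j where ij: "i < 4" "j < 4" "i \<noteq> j" "n i \<noteq> 0" "n j \<noteq> 0" by blast
    \<comment> \<open>A pair in which one size vanishes is bounded as well: the other one pairs with
      \<open>n i\<close> or \<open>n j\<close>.\<close>
    have one: "n k \<le> 48" if "k < 4" for k
      using two[of i k] two[of j k] ij that by (cases "n k = 0"; cases "i = k") auto
    have "n k + n l \<le> 48" if "k < 4" "l < 4" "k \<noteq> l" for k l
      using two[OF that] one[OF that(1)] one[OF that(2)] by (cases "n k = 0"; cases "n l = 0") auto
    from this[of 0 1] this[of 2 3] have "(\<Sum>i<4. n i) \<le> 96" by (simp add: sum4)
    thus ?thesis using X_le m_le by (simp add: s_def)
  next
    case False
    have "\<exists>i<4. \<forall>j<4. j \<noteq> i \<longrightarrow> n j = 0"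
    proof (cases "\<exists>i<4. n i \<noteq> 0")
      case True
      thus ?thesis using False by metis
    qed (use zero_less_numeral in blast)
    then obtain i where i: "i < 4" and rest: "\<And>j. j < 4 \<Longrightarrow> j \<noteq> i \<Longrightarrow> n j = 0" by blast
    have sum_n: "(\<Sum>i<4. n i) = n i"
      using i rest sum.mono_neutral_right[of "{..<4}" "{i}" n] by auto
    show ?thesis
    proof (cases "m = 0")
      case True
      thus ?thesis using X_le sum_n card_singleton_pillar_le[OF i] by (simp add: n_def)
    next
      case False
      then obtain j where "j \<in> {1,2,3}" "pillar {0, j} \<noteq> {}" unfolding m_def by fastforce
      hence "n i \<le> 39" unfolding n_def by (rule card_singleton_pillar_le_39[OF i])
      thus ?thesis using X_le m_le sum_n by (simp add: s_def)
    qed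
  qed
qed

end

theorem proposition4p5:
  fixes r :: nat and X :: "real vec set"
  assumes "equiangular r (1/5) X"
    and "base_size (1/5) X = 4"
  shows "card X \<le> 100 + 3 * max_two_distance (r - 4) (1/13) (-5/13)"
proof -
  obtain q :: "nat \<Rightarrow> real vec" where
    "\<And>i. i < (4::nat) \<Longrightarrow> q i \<in> signed X" and
    "\<And>i j. i < (4::nat) \<Longrightarrow> j < 4 \<Longrightarrow> i \<noteq> j \<Longrightarrow> q i \<bullet> q j = -(1/5)"
    using base_size_attained[OF assms] by blast
  then interpret base_of_four r X q
    using assms obtuse_card_le_base_size[OF assms(1)] by unfold_locales auto
  show ?thesis by (rule card_bound)
qed

end
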